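(* Let $m\ge3$ and let $X_{\mathcal M}$ be a strict Type $\mathcal S$ source. Then omnivocal communication is necessary for achieving SK capacity: for every $T\subset\mathcal M$ with $|T|=m-1$, $$\mathbf I_T(X_{\mathcal M})<\mathbf I(X_{\mathcal M}).$$
   Context: Let $\mathcal M=\{1,\dots,m\}$, and let $X_{\mathcal M}=(X_1,\dots,X_m)$ be jointly distributed finite-valued random variables, observed as $n$ i.i.d. copies $X^n_{\mathcal M}$; $X_A=(X_i:i\in A)$. Communication, CR, SK. An interactive communication $\mathbf F$ is a finite sequence of transmissions, each made by a terminal $i$ as a deterministic function of $X^n_i$ and earlier transmissions. A CR from $\mathbf F$ is a sequence $\mathbf J$ of functions of $X^n_{\mathcal M}$ such that for every $0<\epsilon<1$ and large $n$, there exist $J_i(X^n_i,\mathbf F)$ with $\Pr[J_1=\cdots=J_m=\mathbf J]\ge1-\epsilon$. $R$ is an achievable SK rate if some CR $\mathbf K$ from some $\mathbf F$ satisfies, for every $\epsilon>0$ and large $n$, $I(\mathbf K;\mathbf F)\le\epsilon$ and $\frac1nH(\mathbf K)\ge R-\epsilon$. Multipartite information. $\Delta(\mathcal P)=\frac1{|\mathcal P|-1}[\sum_{A\in\mathcal P}H(X_A)-H(X_{\mathcal M})]$ for partitions with at least 2 cells, and $\mathbf I(X_{\mathcal M})=\min_{\mathcal P}\Delta(\mathcal P)$; this equals the SK capacity (supremum of achievable SK rates). The source is strict Type $\mathcal S$ if the singleton partition $\{\{1\},\dots,\{m\}\}$ is the unique minimizer. Silent terminals. For $T\subsetneq\mathcal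 M$, $\mathbf I_T(X_{\mathcal M})$ is the supremum of achievable SK rates when only interactive communications in which only terminals in $T$ transmit are allowed. *)

theory Defs
  imports "HOL-Probability.Probability" "HOL-Library.Disjoint_Sets"
begin

text \<open>Terminals are 1..m (type nat); every X_i takes values in a common finite
 alphabet 'a. A source is a pmf P on nat => 'a; only the components in {1..m}
 are used (X_M = restrict x {1..m}).\<close>

definition ent :: "'b pmf \<Rightarrow> real" where
  "ent q = (\<Sum>v\<in>set_pmf q. - pmf q v * log 2 (pmf q v))"

definition rv_ent :: "'b pmf \<Rightarrow> ('b \<Rightarrow> 'c) \<Rightarrow> real" where
  "rv_ent p g = ent (map_pmf g p)"

definition mutual_info :: "'b pmf \<Rightarrow> ('b \<Rightarrow> 'c) \<Rightarrow> ('b \<Rightarrow> 'd) \<Rightarrow> real" where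
  "mutual_info p g h = rv_ent p g + rv_ent p h - rv_ent p (\<lambda>x. (g x, h x))"

definition src_ent :: "(nat \<Rightarrow> 'a) pmf \<Rightarrow> nat set \<Rightarrow> real" where
  "src_ent P A = rv_ent P (\<lambda>x. restrict x A)"

definition Delta :: "(nat \<Rightarrow> 'a) pmf \<Rightarrow> nat \<Rightarrow> nat set set \<Rightarrow> real" where
  "Delta P m Q = ((\<Sum>A\<in>Q. src_ent P A) - src_ent P {1..m}) / (real (card Q) - 1)"

definition partitions2 :: "nat \<Rightarrow> nat set set set" where
  "partitions2 m = {Q. partition_on {1..m} Q \<and> card Q \<ge> 2}"

definition mmi :: "(nat \<Rightarrow> 'a) pmf \<Rightarrow> nat \<Rightarrow> real" where
  "mmi P m = Min (Delta P m ` partitions2 m)"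

definition singleton_partition :: "nat \<Rightarrow> nat set set" where
  "singleton_partition m = (\<lambda>i. {i}) ` {1..m}"

definition strict_type_S :: "(nat \<Rightarrow> 'a) pmf \<Rightarrow> nat \<Rightarrow> bool" where
  "strict_type_S P m \<longleftrightarrow>
     singleton_partition m \<in> partitions2 m \<and>
     (\<forall>Q\<in>partitions2 m. Delta P m (singleton_partition m) \<le> Delta P m Q) \<and>
     (\<forall>Q\<in>partitions2 m. Delta P m Q = Delta P m (singleton_partition m) \<longrightarrow> Q = singleton_partition m)"

text \<open>n i.i.d. copies: xs t i = i-th component at time t (t < n).\<close>
definition iid :: "(nat \<Rightarrow> 'a) pmf \<Rightarrow> nat \<Rightarrow> nat \<Rightarrow> (nat \<Rightarrow> nat \<Rightarrow> 'a) pmf" where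
  "iid P m n = Pi_pmf {..<n} undefined (\<lambda>_. map_pmf (\<lambda>x. restrict x {1..m}) P)"

text \<open>An interactive communication: a finite list of transmissions; each is
 (speaker i, rule f), the transmitted value being f (observations of i) (earlier transmissions).\<close>
type_synonym 'a protocol = "(nat \<times> ((nat \<Rightarrow> 'a) \<Rightarrow> nat list \<Rightarrow> nat)) list"

fun run :: "'a protocol \<Rightarrow> (nat \<Rightarrow> nat \<Rightarrow> 'a) \<Rightarrow> nat list \<Rightarrow> nat list" where
  "run [] xs prev = prev"
| "run ((i, f) # ps) xs prev = run ps xs (prev @ [f (\<lambda>t. xs t i) prev])"

definition transcript :: "'a protocol \<Rightarrow> (nat \<Rightarrow> nat \<Rightarrow> 'a) \<Rightarrow> nat list" where
  "transcript ps xs = run ps xs []"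

definition sk_achievable :: "(nat \<Rightarrow> 'a) pmf \<Rightarrow> nat \<Rightarrow> nat set \<Rightarrow> real \<Rightarrow> bool" where
  "sk_achievable P m S R \<longleftrightarrow>
    (\<exists>(F :: nat \<Rightarrow> 'a protocol) (K :: nat \<Rightarrow> (nat \<Rightarrow> nat \<Rightarrow> 'a) \<Rightarrow> nat).
      (\<forall>n. \<forall>(i, f)\<in>set (F n). i \<in> S) \<and>
      (\<forall>\<epsilon>. 0 < \<epsilon> \<and> \<epsilon> < 1 \<longrightarrow>
         (\<forall>\<^sub>F n in sequentially. \<exists>J :: nat \<Rightarrow> (nat \<Rightarrow> 'a) \<Rightarrow> nat list \<Rightarrow> nat.
            measure_pmf.prob (iid P m n)
              {xs. \<forall>i\<in>{1..m}. J i (\<lambda>t. xs t i) (transcript (F n) xs) = K n xs} \<ge> 1 - \<epsilon>)) \<and>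
      (\<forall>\<epsilon>>0. \<forall>\<^sub>F n in sequentially.
         mutual_info (iid P m n) (K n) (transcript (F n)) \<le> \<epsilon> \<and>
         rv_ent (iid P m n) (K n) / real n \<ge> R - \<epsilon>))"

definition sk_cap_restricted :: "(nat \<Rightarrow> 'a) pmf \<Rightarrow> nat \<Rightarrow> nat set \<Rightarrow> real" where
  "sk_cap_restricted P m T = Sup {R. sk_achievable P m T R}"

end

(* Let u be the silent terminal. Total correlation of X_T, the sum over T of H(X_i) minus H(X_T), does not
   increase when one conditions on communication by the terminals in T, and each of these terminals ends
   up knowing the key. Hence every achievable rate is at most
   (sum over T of H(X_i) - H(X_T)) / (m - 2), which is Delta of the singleton partition of T; the
   key need not be a function of X_T, and u may be ignored altogether. Strictness comes from comparing the
   singleton partition of {1..m} with the partition {{u}, T}: its Delta is H(X_u) + H(X_T) - H(X_M),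
   and the total correlation of X_M is that of X_T plus this quantity, so if the quantity exceeds
   Delta of the singletons of {1..m}, then Delta of the singletons of T is below it. *)

theory Submission
  imports Defs
begin

section \<open>Entropy of finitely supported random variables\<close>

lemma pmf_map_finite:
  assumes "finite (set_pmf p)"
  shows "pmf (map_pmf g p) v = (\<Sum>x | x \<in> set_pmf p \<and> g x = v. pmf p x)"
proof -
  have "pmf (map_pmf g p) v = measure p (g -` {v} \<inter> set_pmf p)"
    by (simp add: pmf_map measure_Int_set_pmf)
  also have "g -` {v} \<inter> set_pmf p = {x. x \<in> set_pmf p \<and> g x = v}"
    by auto
  finally show ?thesis
    using assms by (simp add: measure_measure_pmf_finite)
qed

text \<open>Change of variables for expectations: group the support of \<open>p\<close> by the value
  of \<open>g\<close>.\<close>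

lemma sum_pmf_map:
  assumes "finite (set_pmf p)"
  shows "(\<Sum>v\<in>g ` set_pmf p. pmf (map_pmf g p) v * c v) = (\<Sum>x\<in>set_pmf p. pmf p x * c (g x))"
proof -
  have "(\<Sum>x\<in>set_pmf p. pmf p x * c (g x))
      = (\<Sum>v\<in>g ` set_pmf p. \<Sum>x | x \<in> set_pmf p \<and> g x = v. pmf p x * c (g x))"
    using sum.group[of "set_pmf p" "g ` set_pmf p" g "\<lambda>x. pmf p x * c (g x)"] assms by simp
  also have "\<dots> = (\<Sum>v\<in>g ` set_pmf p. pmf (map_pmf g p) v * c v)"
    by (intro sum.cong) (auto simp: pmf_map_finite[OF assms] sum_distrib_right intro!: sum.cong)
  finally show ?thesis by simp
qed

lemma sum_pmf_map_eq_1: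
  assumes "finite (set_pmf p)"
  shows "(\<Sum>v\<in>g ` set_pmf p. pmf (map_pmf g p) v) = 1"
  using sum_pmf_map[OF assms, of g "\<lambda>_. 1"] sum_pmf_eq_1[OF assms] by simp

lemma pmf_map_pos: "x \<in> set_pmf p \<Longrightarrow> pmf (map_pmf g p) (g x) > 0"
  by (auto simp: pmf_positive_iff)

text \<open>Written this way, entropies of different functions become expectations over the one
  sample space \<open>set_pmf p\<close>, so they can be compared and added term by term.\<close>

lemma rv_ent_eq:
  assumes "finite (set_pmf p)"
  shows "rv_ent p g = - (\<Sum>x\<in>set_pmf p. pmf p x * log 2 (pmf (map_pmf g p) (g x)))"
  using sum_pmf_map[OF assms, of g "\<lambda>v. log 2 (pmf (map_pmf g p) v)"]
  by (simp add: rv_ent_def ent_def sum_negf)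

text \<open>Nonnegativity of relative entropy, from \<open>ln y <= y - 1\<close> at
  \<open>y = q / r\<close>. The weights \<open>q\<close> may form a sub-probability; strong
  subadditivity and Fano below each come from one choice of \<open>q\<close>.\<close>

lemma gibbs_inequality:
  assumes fin: "finite (set_pmf p)"
    and pos: "\<And>x. x \<in> set_pmf p \<Longrightarrow> q (g x) > 0"
    and le1: "(\<Sum>v\<in>g ` set_pmf p. q v) \<le> 1"
  shows "rv_ent p g \<le> - (\<Sum>x\<in>set_pmf p. pmf p x * log 2 (q (g x)))"
proof -
  let ?r = "pmf (map_pmf g p)"
  have "?r v * log 2 (q v) - ?r v * log 2 (?r v) \<le> (q v - ?r v) / ln 2"
    if v: "v \<in> g ` set_pmf p" for v
  proof -
    have r: "?r v > 0" and q: "q v > 0" using v pmf_map_pos pos by auto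
    have "ln (q v / ?r v) \<le> q v / ?r v - 1" using r q by (intro ln_le_minus_one) simp
    then have "?r v * (ln (q v) - ln (?r v)) \<le> ?r v * (q v / ?r v - 1)"
      using r q by (intro mult_left_mono) (auto simp: ln_div)
    also have "\<dots> = q v - ?r v" using r by (simp add: field_simps)
    finally have "(?r v * (ln (q v) - ln (?r v))) / ln 2 \<le> (q v - ?r v) / ln 2"
      by (rule divide_right_mono) simp
    then show ?thesis by (simp add: log_def right_diff_distrib diff_divide_distrib)
  qed
  then have "(\<Sum>v\<in>g ` set_pmf p. ?r v * log 2 (q v) - ?r v * log 2 (?r v))
      \<le> (\<Sum>v\<in>g ` set_pmf p. (q v - ?r v) / ln 2)"
    by (rule sum_mono)
  also have "\<dots> = ((\<Sum>v\<in>g ` set_pmf p. q v) - 1) / ln 2"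
    by (simp add: sum_subtractf sum_pmf_map_eq_1[OF fin] flip: sum_divide_distrib)
  also have "\<dots> \<le> 0" using le1 by (simp add: divide_le_0_iff)
  finally have "(\<Sum>v\<in>g ` set_pmf p. ?r v * log 2 (q v)) \<le> (\<Sum>v\<in>g ` set_pmf p. ?r v * log 2 (?r v))"
    by (simp add: sum_subtractf)
  then show ?thesis
    using sum_pmf_map[OF fin, of g "\<lambda>v. log 2 (q v)"]
      sum_pmf_map[OF fin, of g "\<lambda>v. log 2 (?r v)"]
    by (simp add: rv_ent_eq[OF fin])
qed

text \<open>On the support, every fibre of \<open>h\<close> lies inside a fibre of \<open>g\<close>,
  so the atoms of \<open>g\<close> are at least as heavy and carry no more surprise.\<close>

lemma rv_ent_mono:
  assumes fin: "finite (set_pmf p)"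
    and det: "\<And>x y. x \<in> set_pmf p \<Longrightarrow> y \<in> set_pmf p \<Longrightarrow> h x = h y \<Longrightarrow> g x = g y"
  shows "rv_ent p g \<le> rv_ent p h"
proof -
  have "pmf p x * log 2 (pmf (map_pmf h p) (h x)) \<le> pmf p x * log 2 (pmf (map_pmf g p) (g x))"
    if x: "x \<in> set_pmf p" for x
  proof -
    have "pmf (map_pmf h p) (h x) \<le> pmf (map_pmf g p) (g x)"
      unfolding pmf_map_finite[OF fin]
    proof (rule sum_mono2)
      show "{y \<in> set_pmf p. h y = h x} \<subseteq> {y \<in> set_pmf p. g y = g x}"
        using det[OF _ x] by blast
    qed (use fin in auto)
    then show ?thesis
      using pmf_map_pos[OF x, of h] by (intro mult_left_mono log_mono) auto
  qed
  then show ?thesis by (simp add: rv_ent_eq[OF fin] sum_mono)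
qed

text \<open>Entropy depends only on the partition of the support into fibres. This is what regroups,
  reorders and re-encodes tuples below, even across different value types.\<close>

lemma rv_ent_cong:
  assumes "finite (set_pmf p)"
    and "\<And>x y. x \<in> set_pmf p \<Longrightarrow> y \<in> set_pmf p \<Longrightarrow> g x = g y \<longleftrightarrow> h x = h y"
  shows "rv_ent p g = rv_ent p h"
  using rv_ent_mono[of p g h] rv_ent_mono[of p h g] assms by (meson order_antisym)

lemma rv_ent_const: "rv_ent p (\<lambda>_. c) = 0"
  by (simp add: rv_ent_def ent_def)

section \<open>Strong subadditivity\<close>

lemma sum_pmf_fibre_le:
  assumes fin: "finite (set_pmf p)"
    and S: "S \<subseteq> g ` set_pmf p" and \<phi>: "\<And>x. x \<in> set_pmf p \<Longrightarrow> g x \<in> S \<Longrightarrow> h x = c"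
  shows "(\<Sum>v\<in>S. pmf (map_pmf g p) v) \<le> pmf (map_pmf h p) c"
proof -
  have fS: "finite S" using S fin finite_surj by blast
  have "(\<Sum>v\<in>S. pmf (map_pmf g p) v) = (\<Sum>v\<in>S. \<Sum>x | x \<in> {x\<in>set_pmf p. g x \<in> S} \<and> g x = v. pmf p x)"
    by (auto simp: pmf_map_finite[OF fin] intro!: sum.cong)
  also have "\<dots> = (\<Sum>x | x \<in> set_pmf p \<and> g x \<in> S. pmf p x)"
    using fin fS by (intro sum.group) auto
  also have "\<dots> \<le> pmf (map_pmf h p) c"
    unfolding pmf_map_finite[OF fin] using fin \<phi> by (intro sum_mono2) auto
  finally show ?thesis .
qed

text \<open>This is \<open>I(g; h | k) >= 0\<close>: Gibbs' inequality against the law with the same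
  \<open>(g, k)\<close> and \<open>(h, k)\<close> marginals under which \<open>g\<close> and
  \<open>h\<close> are conditionally independent given \<open>k\<close>.\<close>

lemma strong_subadditivity:
  assumes fin: "finite (set_pmf p)"
  shows "rv_ent p (\<lambda>x. (g x, h x, k x)) + rv_ent p k
    \<le> rv_ent p (\<lambda>x. (g x, k x)) + rv_ent p (\<lambda>x. (h x, k x))"
proof -
  let ?S = "set_pmf p" and ?G = "\<lambda>x. (g x, h x, k x)"
  let ?a = "\<lambda>u w. pmf (map_pmf (\<lambda>x. (g x, k x)) p) (u, w)"
  let ?b = "\<lambda>v w. pmf (map_pmf (\<lambda>x. (h x, k x)) p) (v, w)"
  let ?c = "pmf (map_pmf k p)"
  let ?q = "\<lambda>(u, v, w). ?a u w * (?b v w / ?c w)"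
  have pos: "?a (g x) (k x) > 0" "?b (h x) (k x) > 0" "?c (k x) > 0" if "x \<in> ?S" for x
    using pmf_map_pos[OF that, of "\<lambda>x. (g x, k x)"] pmf_map_pos[OF that, of "\<lambda>x. (h x, k x)"]
      pmf_map_pos[OF that, of k] by auto
  \<comment> \<open>Enlarging the range to all combinations of a value of \<open>(g, k)\<close> with
    a value of \<open>h\<close> only adds nonnegative terms and lets the sum factor.\<close>
  have "(\<Sum>z\<in>?G ` ?S. ?q z)
      \<le> (\<Sum>z\<in>(\<lambda>((u, w), v). (u, v, w)) ` ((\<lambda>x. (g x, k x)) ` ?S \<times> h ` ?S). ?q z)"
  proof (rule sum_mono2)
    show "?G ` ?S \<subseteq> (\<lambda>((u, w), v). (u, v, w)) ` ((\<lambda>x. (g x, k x)) ` ?S \<times> h ` ?S)"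
      by (force simp: image_iff)
  qed (use fin in auto)
  also have "\<dots> = (\<Sum>((u, w), v)\<in>(\<lambda>x. (g x, k x)) ` ?S \<times> h ` ?S. ?a u w * (?b v w / ?c w))"
    by (subst sum.reindex) (auto simp: inj_on_def intro!: sum.cong)
  also have "\<dots> = (\<Sum>z\<in>(\<lambda>x. (g x, k x)) ` ?S. pmf (map_pmf (\<lambda>x. (g x, k x)) p) z *
      (\<Sum>v\<in>h ` ?S. ?b v (snd z) / ?c (snd z)))"
    unfolding sum_distrib_left sum.cartesian_product by (auto intro!: sum.cong)
  also have "\<dots> \<le> (\<Sum>z\<in>(\<lambda>x. (g x, k x)) ` ?S. pmf (map_pmf (\<lambda>x. (g x, k x)) p) z * 1)"
  proof (intro sum_mono mult_left_mono)
    fix z assume "z \<in> (\<lambda>x. (g x, k x)) ` ?S"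
    then have c: "?c (snd z) > 0" using pos by auto
    \<comment> \<open>Values outside \<open>?V\<close> have no mass jointly with
      \<open>snd z\<close>. The pairs from \<open>?V\<close> have disjoint fibres inside the fibre
      of \<open>k\<close> over \<open>snd z\<close>, so the conditional law of \<open>h\<close> sums
      to at most 1.\<close>
    let ?V = "{v \<in> h ` ?S. (v, snd z) \<in> (\<lambda>x. (h x, k x)) ` ?S}"
    have "(\<Sum>v\<in>h ` ?S. ?b v (snd z)) = (\<Sum>v\<in>?V. ?b v (snd z))"
      using fin by (intro sum.mono_neutral_right) (auto simp: set_pmf_eq[symmetric] pmf_eq_0_set_pmf)
    also have "\<dots> = (\<Sum>y\<in>(\<lambda>v. (v, snd z)) ` ?V. pmf (map_pmf (\<lambda>x. (h x, k x)) p) y)"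
      by (subst sum.reindex) (auto simp: inj_on_def)
    also have "\<dots> \<le> ?c (snd z)"
      by (rule sum_pmf_fibre_le[OF fin]) auto
    finally show "(\<Sum>v\<in>h ` ?S. ?b v (snd z) / ?c (snd z)) \<le> 1"
      using c by (simp flip: sum_divide_distrib)
  qed auto
  also have "\<dots> = 1" by (simp add: sum_pmf_map_eq_1[OF fin])
  finally have "rv_ent p ?G \<le> - (\<Sum>x\<in>?S. pmf p x * log 2 (?q (?G x)))"
    using pos by (intro gibbs_inequality[OF fin]) auto
  also have "(\<Sum>x\<in>?S. pmf p x * log 2 (?q (?G x)))
      = (\<Sum>x\<in>?S. pmf p x * log 2 (?a (g x) (k x)) + pmf p x * log 2 (?b (h x) (k x))
          - pmf p x * log 2 (?c (k x)))"
    using pos by (intro sum.cong)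
      (auto simp: log_mult log_divide algebra_simps less_imp_neq[THEN not_sym])
  finally show ?thesis
    by (simp add: rv_ent_eq[OF fin] sum.distrib sum_subtractf)
qed

text \<open>The comparison law given \<open>z\<close> mixes the point mass at the estimate \<open>j z\<close> and the uniform law with
  weights 1/2 each; the binary entropy of the error event is thereby replaced by 1.\<close>

lemma fano_inequality:
  assumes fin: "finite (set_pmf p)"
    and N: "real (card (K ` set_pmf p)) \<le> N"
    and err: "measure_pmf.prob p {x. j (Z x) = K x} \<ge> 1 - \<epsilon>"
  shows "rv_ent p (\<lambda>x. (K x, Z x)) - rv_ent p Z \<le> 1 + \<epsilon> * log 2 N"
proof -
  let ?S = "set_pmf p" and ?G = "\<lambda>x. (K x, Z x)"
  let ?c = "pmf (map_pmf Z p)"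
  define t where "t k z = (if k = j z then 1/2 else 0) + 1 / (2 * N)" for k z
  let ?q = "\<lambda>(k, z). ?c z * t k z"
  have "card (K ` ?S) \<noteq> 0" using fin set_pmf_not_empty by auto
  then have N1: "N \<ge> 1" using N by linarith
  have t: "t k z > 0" for k z using N1 by (auto simp: t_def intro: add_pos_pos)
  \<comment> \<open>The point mass contributes at most 1/2, as the estimate \<open>j z\<close> may
    fall outside the range of \<open>K\<close>; the uniform part contributes at most 1/2 because
    that range has at most \<open>N\<close> values.\<close>
  have t_sum: "(\<Sum>k\<in>K ` ?S. t k z) \<le> 1" for z
  proof -
    have "(\<Sum>k\<in>K ` ?S. if k = j z then 1/2 else (0::real)) \<le> 1/2"
      using fin by (simp add: sum.delta)
    moreover have "(\<Sum>k\<in>K ` ?S. 1 / (2 * N)) \<le> 1/2"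
      using N N1 by (simp add: field_simps)
    ultimately show ?thesis
      unfolding t_def by (simp only: sum.distrib)
  qed
  \<comment> \<open>A correct estimate has weight at least 1/2 and costs at most one bit; a wrong
    one has weight \<open>1 / (2 * N)\<close> and costs \<open>1 + log 2 N\<close>.\<close>
  have t_log: "- log 2 (t k z) \<le> 1 + (if j z = k then 0 else log 2 N)" for k z
  proof (cases "j z = k")
    case True
    have "log 2 (1/2) \<le> log 2 (t k z)"
      using N1 True by (subst log_le_cancel_iff) (auto simp: t_def intro: add_pos_pos)
    then show ?thesis using True by (simp add: log_divide)
  next
    case False
    then show ?thesis using N1 by (auto simp: t_def log_divide log_mult)
  qed
  have c: "?c (Z x) > 0" if "x \<in> ?S" for x using pmf_map_pos[OF that] .
  have "(\<Sum>y\<in>?G ` ?S. ?q y) \<le> (\<Sum>y\<in>K ` ?S \<times> Z ` ?S. ?q y)"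
    using fin by (intro sum_mono2) (auto simp: less_imp_le[OF t])
  also have "\<dots> = (\<Sum>k\<in>K ` ?S. \<Sum>z\<in>Z ` ?S. ?c z * t k z)"
    by (rule sum.cartesian_product[symmetric])
  also have "\<dots> = (\<Sum>z\<in>Z ` ?S. ?c z * (\<Sum>k\<in>K ` ?S. t k z))"
    unfolding sum_distrib_left by (rule sum.swap)
  also have "\<dots> \<le> (\<Sum>z\<in>Z ` ?S. ?c z * 1)"
    by (intro sum_mono mult_left_mono t_sum) simp
  also have "\<dots> = 1" by (simp add: sum_pmf_map_eq_1[OF fin])
  finally have "rv_ent p ?G \<le> - (\<Sum>x\<in>?S. pmf p x * log 2 (?q (?G x)))"
    using c t by (intro gibbs_inequality[OF fin]) simp_all
  also have "(\<Sum>x\<in>?S. pmf p x * log 2 (?q (?G x)))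
      = (\<Sum>x\<in>?S. pmf p x * log 2 (?c (Z x)) + pmf p x * log 2 (t (K x) (Z x)))"
    using c t by (intro sum.cong refl) (simp add: log_mult_pos distrib_left)
  also have "- \<dots> = rv_ent p Z + (\<Sum>x\<in>?S. pmf p x * - log 2 (t (K x) (Z x)))"
    by (simp add: rv_ent_eq[OF fin] sum.distrib sum_negf)
  also have "(\<Sum>x\<in>?S. pmf p x * - log 2 (t (K x) (Z x)))
      \<le> (\<Sum>x\<in>?S. pmf p x * (1 + (if j (Z x) = K x then 0 else log 2 N)))"
    by (intro sum_mono mult_left_mono t_log) simp
  also have "\<dots> = (\<Sum>x\<in>?S. pmf p x + (pmf p x - (if j (Z x) = K x then pmf p x else 0)) * log 2 N)"
    by (intro sum.cong) (auto simp: distrib_left)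
  also have "\<dots> = 1 + (1 - (\<Sum>x\<in>?S. if j (Z x) = K x then pmf p x else 0)) * log 2 N"
    by (simp only: sum.distrib sum_subtractf sum_distrib_right[symmetric] sum_pmf_eq_1[OF fin order_refl])
  also have "(\<Sum>x\<in>?S. if j (Z x) = K x then pmf p x else 0) = measure_pmf.prob p {x. j (Z x) = K x}"
  proof -
    have "measure_pmf.prob p {x. j (Z x) = K x} = measure_pmf.prob p (?S \<inter> {x. j (Z x) = K x})"
      by (subst Int_commute) (simp only: measure_Int_set_pmf)
    also have "\<dots> = sum (pmf p) (?S \<inter> {x. j (Z x) = K x})"
      using fin by (simp add: measure_measure_pmf_finite)
    also have "\<dots> = (\<Sum>x\<in>?S. if j (Z x) = K x then pmf p x else 0)"
      using fin by (simp add: sum.inter_restrict)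
    finally show ?thesis by simp
  qed
  finally have "rv_ent p ?G \<le> rv_ent p Z + (1 + (1 - measure_pmf.prob p {x. j (Z x) = K x}) * log 2 N)"
    by simp
  moreover have "(1 - measure_pmf.prob p {x. j (Z x) = K x}) * log 2 N \<le> \<epsilon> * log 2 N"
    using err N1 by (intro mult_right_mono) auto
  ultimately show ?thesis by simp
qed

text \<open>Induction on \<open>T\<close>: strong subadditivity given \<open>Z\<close> splits off
  one component at a time.\<close>

lemma conditional_subadditivity:
  assumes fin: "finite (set_pmf p)" and "finite T"
  shows "rv_ent p (\<lambda>x. (\<lambda>i\<in>T. X i x, Z x)) - rv_ent p Z
    \<le> (\<Sum>i\<in>T. rv_ent p (\<lambda>x. (X i x, Z x)) - rv_ent p Z)"
  using \<open>finite T\<close>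
proof induction
  case empty
  show ?case
    by (simp, rule rv_ent_mono[OF fin]) auto
next
  case (insert i T)
  have "rv_ent p (\<lambda>x. (\<lambda>i\<in>insert i T. X i x, Z x)) = rv_ent p (\<lambda>x. (X i x, \<lambda>i\<in>T. X i x, Z x))"
    by (rule rv_ent_cong[OF fin]) (auto simp: restrict_def fun_eq_iff)
  then show ?case
    using insert strong_subadditivity[OF fin, of "X i" "\<lambda>x. \<lambda>i\<in>T. X i x" Z]
    by (simp del: restrict_apply add: restrict_def)
qed

section \<open>Entropy of an i.i.d. sequence\<close>

lemma ent_pair_pmf:
  assumes "finite (set_pmf p)" "finite (set_pmf q)"
  shows "ent (pair_pmf p q) = ent p + ent q"
proof -
  have "ent (pair_pmf p q) = (\<Sum>x\<in>set_pmf p. \<Sum>y\<in>set_pmf q.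
      (- pmf p x * log 2 (pmf p x)) * pmf q y + pmf p x * (- pmf q y * log 2 (pmf q y)))"
    unfolding ent_def set_pair_pmf sum.cartesian_product
    by (intro sum.cong) (auto simp: pmf_pair log_mult algebra_simps set_pmf_iff)
  also have "\<dots> = ent p + ent q"
    unfolding sum.distrib sum_distrib_left[symmetric] sum_distrib_right[symmetric]
    by (simp add: sum_pmf_eq_1 assms ent_def sum_product[symmetric])
  finally show ?thesis .
qed

lemma ent_map_inj:
  assumes "inj_on g (set_pmf p)"
  shows "ent (map_pmf g p) = ent p"
  unfolding ent_def using assms by (simp add: sum.reindex pmf_map_inj)

lemma finite_set_Pi_pmf:
  assumes "finite A" "\<And>x. x \<in> A \<Longrightarrow> finite (set_pmf (p x))"
  shows "finite (set_pmf (Pi_pmf A d p))"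
  using assms by (auto simp: set_Pi_pmf intro!: finite_PiE_dflt)

lemma ent_Pi_pmf:
  assumes "finite A" "finite (set_pmf q)"
  shows "ent (Pi_pmf A d (\<lambda>_. q)) = card A * ent q"
  using assms(1)
proof induction
  case empty
  then show ?case by (simp add: ent_def)
next
  case (insert a A)
  have "ent (Pi_pmf (insert a A) d (\<lambda>_. q)) = ent (pair_pmf q (Pi_pmf A d (\<lambda>_. q)))"
    unfolding Pi_pmf_insert[OF insert.hyps]
  proof (rule ent_map_inj, rule inj_onI, clarsimp)
    fix y f y' f'
    assume f: "f \<in> set_pmf (Pi_pmf A d (\<lambda>_. q))" "f' \<in> set_pmf (Pi_pmf A d (\<lambda>_. q))"
      and eq: "f(a := y) = f'(a := y')"
    \<comment> \<open>Both functions have the default \<open>d\<close> at \<open>a\<close>, so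
      overwriting that coordinate loses no information.\<close>
    have "f a = f' a"
      using f insert.hyps by (auto simp: set_Pi_pmf PiE_dflt_def)
    then show "y = y' \<and> f = f'"
      using eq by (metis fun_upd_eqD fun_upd_triv fun_upd_upd)
  qed
  also have "\<dots> = ent q + card A * ent q"
    using insert assms(2) by (subst ent_pair_pmf) (auto intro: finite_set_Pi_pmf)
  finally show ?case using insert by (simp add: algebra_simps)
qed

lemma finite_image_restrict:
  assumes "finite A"
  shows "finite ((\<lambda>x. restrict x A) ` (S :: ('b \<Rightarrow> 'a::finite) set))"
    and "card ((\<lambda>x. restrict x A) ` S) \<le> CARD('a) ^ card A"
proof -
  have sub: "(\<lambda>x. restrict x A) ` S \<subseteq> PiE A (\<lambda>_. UNIV)" by auto
  have fin: "finite (PiE A (\<lambda>_. UNIV :: 'a set))" using assms by (intro finite_PiE) auto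
  show "finite ((\<lambda>x. restrict x A) ` S)" using sub fin by (rule finite_subset)
  show "card ((\<lambda>x. restrict x A) ` S) \<le> CARD('a) ^ card A"
    using card_mono[OF fin sub] assms by (simp add: card_PiE)
qed

text \<open>The key is an arbitrary \<open>nat\<close>-valued function; this count bounds its range,
  so that Fano's penalty grows only linearly in \<open>n\<close>.\<close>

lemma set_iid:
  fixes P :: "(nat \<Rightarrow> 'a::finite) pmf"
  shows "finite (set_pmf (iid P m n))"
    and "card (set_pmf (iid P m n)) \<le> (CARD('a) ^ m) ^ n"
proof -
  let ?B = "(\<lambda>x. restrict x {1..m}) ` set_pmf P"
  have B: "finite ?B" "card ?B \<le> CARD('a) ^ m"
    using finite_image_restrict[of "{1..m}" "set_pmf P"] by simp_all
  have set: "set_pmf (iid P m n) = PiE_dflt {..<n} undefined (\<lambda>_. ?B)"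
    unfolding iid_def by (subst set_Pi_pmf) (simp_all add: o_def)
  show "finite (set_pmf (iid P m n))"
    unfolding set using B(1) by (intro finite_PiE_dflt) auto
  have "card (set_pmf (iid P m n)) = card ?B ^ n"
    unfolding set using B(1) by (subst card_PiE_dflt) auto
  then show "card (set_pmf (iid P m n)) \<le> (CARD('a) ^ m) ^ n"
    using B(2) by (simp add: power_mono)
qed

lemma rv_ent_iid:
  fixes P :: "(nat \<Rightarrow> 'a::finite) pmf"
  assumes "A \<subseteq> {1..m}"
  shows "rv_ent (iid P m n) (\<lambda>xs t. restrict (xs t) A) = n * src_ent P A"
proof -
  let ?Q = "map_pmf (\<lambda>x. restrict x {1..m}) P"
  have "(\<lambda>xs t. restrict (xs t) A) = (\<lambda>xs. (\<lambda>x. restrict x A) \<circ> (xs :: nat \<Rightarrow> nat \<Rightarrow> 'a))"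
    by (auto simp: fun_eq_iff)
  \<comment> \<open>Restriction also acts on the default taken at times outside
    \<open>{..<n}\<close>, whence \<open>restrict undefined A\<close>.\<close>
  then have "map_pmf (\<lambda>xs t. restrict (xs t) A) (iid P m n)
      = Pi_pmf {..<n} (restrict undefined A) (\<lambda>_. map_pmf (\<lambda>x. restrict x A) ?Q)"
    unfolding iid_def by (subst Pi_pmf_map[of _ _ undefined]) auto
  moreover have "map_pmf (\<lambda>x. restrict x A) ?Q = map_pmf (\<lambda>x. restrict x A) P"
    using assms by (simp add: map_pmf_comp Int_absorb1)
  moreover have "finite (set_pmf (map_pmf (\<lambda>x. restrict x A) P))"
    using finite_image_restrict(1)[of A "set_pmf P"] assms finite_subset by auto
  ultimately show ?thesis
    by (simp add: rv_ent_def src_ent_def ent_Pi_pmf)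
qed

section \<open>Interactive communication\<close>

text \<open>\<open>run\<close> consumes a protocol from the front, whereas the converse inducts on
  the last transmission.\<close>

lemma run_snoc:
  "run (ps @ [(i, f)]) xs prev = run ps xs prev @ [f (\<lambda>t. xs t i) (run ps xs prev)]"
  by (induction ps xs prev rule: run.induct) auto

lemma transcript_snoc:
  "transcript (ps @ [(i, f)]) xs = transcript ps xs @ [f (\<lambda>t. xs t i) (transcript ps xs)]"
  by (simp add: transcript_def run_snoc)

text \<open>Each transmission is a function of one speaker's observation and the past, so the speaker alone
  contributes its full conditional entropy to the sum of informations.\<close>

lemma transcript_entropy_le_sum_mutual_info:
  assumes fin: "finite (set_pmf p)" and T: "finite T"
    and speakers: "\<forall>(i, f)\<in>set ps. i \<in> T"
  shows "rv_ent p (transcript ps) \<le> (\<Sum>i\<in>T. mutual_info p (\<lambda>xs t. xs t i) (transcript ps))"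
  using speakers
proof (induction ps rule: rev_induct)
  case Nil
  have "rv_ent p (\<lambda>xs. (\<lambda>t. xs t i, [] :: nat list)) = rv_ent p (\<lambda>xs t. xs t i)" for i
    by (rule rv_ent_cong[OF fin]) auto
  then show ?case by (simp add: transcript_def[abs_def] rv_ent_const mutual_info_def)
next
  case (snoc a ps)
  obtain i f where a: "a = (i, f)" by (cases a)
  have i: "i \<in> T" using snoc.prems a by simp
  let ?G = "transcript ps" and ?F = "transcript (ps @ [a])"
  let ?v = "\<lambda>xs. f (\<lambda>t. xs t i) (?G xs)"
  let ?I = "\<lambda>F j. mutual_info p (\<lambda>xs t. xs t j) F"
  have F: "?F xs = ?G xs @ [?v xs]" for xs by (simp add: a transcript_snoc)
  have FG: "rv_ent p (\<lambda>xs. (?v xs, ?G xs)) = rv_ent p ?F"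
    by (rule rv_ent_cong[OF fin]) (auto simp: F)
  have XF: "rv_ent p (\<lambda>xs. (\<lambda>t. xs t j, ?v xs, ?G xs)) = rv_ent p (\<lambda>xs. (\<lambda>t. xs t j, ?F xs))" for j
    by (rule rv_ent_cong[OF fin]) (auto simp: F)
  \<comment> \<open>The new symbol is a function of what the speaker already holds, so its joint
    entropy with the transcript is unchanged.\<close>
  have "rv_ent p (\<lambda>xs. (\<lambda>t. xs t i, ?F xs)) = rv_ent p (\<lambda>xs. (\<lambda>t. xs t i, ?G xs))"
    by (rule rv_ent_cong[OF fin]) (auto simp: F)
  then have speaker: "?I ?F i = ?I ?G i + (rv_ent p ?F - rv_ent p ?G)"
    by (simp add: mutual_info_def)
  \<comment> \<open>For every terminal, extending the transcript cannot decrease its information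
    about that terminal's observation.\<close>
  have listener: "?I ?G j \<le> ?I ?F j" for j
    using strong_subadditivity[OF fin, of "\<lambda>xs t. xs t j" ?v ?G]
    by (simp add: mutual_info_def FG XF)
  have "rv_ent p ?F = rv_ent p ?G + (rv_ent p ?F - rv_ent p ?G)" by simp
  also have "\<dots> \<le> sum (?I ?G) T + (rv_ent p ?F - rv_ent p ?G)"
    using snoc by simp
  also have "\<dots> = ?I ?F i + sum (?I ?G) (T - {i})"
    using speaker T i by (simp add: sum.remove)
  also have "\<dots> \<le> ?I ?F i + sum (?I ?F) (T - {i})"
    by (intro add_left_mono sum_mono listener)
  also have "\<dots> = sum (?I ?F) T" using T i by (simp add: sum.remove)
  finally show ?case .
qed

lemma restrict_eq_restrict_iff: "restrict f A = restrict g A \<longleftrightarrow> (\<forall>x\<in>A. f x = g x)"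
  by (metis restrict_apply' restrict_ext)

text \<open>Conditioning on the communication does not increase the total correlation of the speakers'
  observations, and after it each of them shares (almost) all of \<open>K\<close>.\<close>

lemma secret_key_converse:
  fixes d :: real
  assumes fin: "finite (set_pmf p)" and T: "finite T"
    and speakers: "\<forall>(i, f)\<in>set ps. i \<in> T"
    and recover: "\<And>i. i \<in> T \<Longrightarrow> rv_ent p (\<lambda>xs. (K xs, \<lambda>t. xs t i, transcript ps xs))
      - rv_ent p (\<lambda>xs. (\<lambda>t. xs t i, transcript ps xs)) \<le> d"
  shows "(real (card T) - 1) * (rv_ent p K - mutual_info p K (transcript ps))
    \<le> (\<Sum>i\<in>T. rv_ent p (\<lambda>xs t. xs t i)) - rv_ent p (\<lambda>xs t. restrict (xs t) T) + card T * d"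
proof -
  let ?F = "transcript ps"
  let ?X = "\<lambda>i xs t. xs t i" and ?XT = "\<lambda>xs. \<lambda>i\<in>T. \<lambda>t. xs t i"
  let ?KF = "\<lambda>xs. (K xs, ?F xs)"
  let ?H = "\<lambda>i. rv_ent p (\<lambda>xs. (?X i xs, ?F xs))"
  \<comment> \<open>Two encodings of the observations of \<open>T\<close>: one vector per time, as
    in the i.i.d. entropy formula, and one sequence per terminal, as in conditional subadditivity.
    They have the same fibres.\<close>
  have XT_iff: "?XT xs = ?XT ys \<longleftrightarrow> (\<lambda>t. restrict (xs t) T) = (\<lambda>t. restrict (ys t) T)"
    for xs ys
    by (auto simp: restrict_eq_restrict_iff fun_eq_iff)
  have XT: "rv_ent p (\<lambda>xs t. restrict (xs t) T) = rv_ent p ?XT"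
    by (rule rv_ent_cong[OF fin]) (use XT_iff in blast)
  have cond: "rv_ent p (\<lambda>xs. (?XT xs, ?KF xs)) - rv_ent p ?KF
      \<le> (\<Sum>i\<in>T. rv_ent p (\<lambda>xs. (?X i xs, ?KF xs)) - rv_ent p ?KF)"
    by (rule conditional_subadditivity[OF fin T])
  have "rv_ent p (\<lambda>xs. (?X i xs, ?KF xs)) = rv_ent p (\<lambda>xs. (K xs, ?X i xs, ?F xs))" for i
    by (rule rv_ent_cong[OF fin]) auto
  then have "(\<Sum>i\<in>T. rv_ent p (\<lambda>xs. (?X i xs, ?KF xs)) - rv_ent p ?KF)
      \<le> (\<Sum>i\<in>T. (?H i + d) - rv_ent p ?KF)"
    using recover by (intro sum_mono) (smt (verit, best))
  also have "\<dots> = sum ?H T + card T * d - card T * rv_ent p ?KF"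
    by (simp add: sum.distrib sum_subtractf)
  finally have upper: "rv_ent p (\<lambda>xs. (?XT xs, ?KF xs)) - rv_ent p ?KF
      \<le> sum ?H T + card T * d - card T * rv_ent p ?KF"
    using cond by simp
  \<comment> \<open>\<open>K\<close> may depend on observations outside \<open>T\<close>, so in
    general this is only an inequality.\<close>
  have "rv_ent p ?XT \<le> rv_ent p (\<lambda>xs. (?XT xs, ?KF xs))"
    by (rule rv_ent_mono[OF fin]) auto
  moreover have "rv_ent p ?F \<le> (\<Sum>i\<in>T. rv_ent p (?X i)) + card T * rv_ent p ?F - sum ?H T"
    using transcript_entropy_le_sum_mutual_info[OF fin T speakers]
    by (simp add: mutual_info_def sum.distrib sum_subtractf)
  \<comment> \<open>Combining the bounds leaves \<open>card T - 1\<close> copies of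
    \<open>H(K, F) - H(F)\<close>, which equals \<open>H(K) - I(K; F)\<close>.\<close>
  ultimately show ?thesis
    using upper by (simp add: XT mutual_info_def algebra_simps)
qed

section \<open>The capacity bound\<close>

text \<open>The converse at block length \<open>n\<close> is combined with Fano's inequality for
  each terminal in \<open>T\<close>, divided by \<open>n\<close>, and passed to the limit first in
  \<open>n\<close>, then in the error.\<close>

lemma sk_achievable_le:
  fixes P :: "(nat \<Rightarrow> 'a::finite) pmf"
  assumes ach: "sk_achievable P m T R" and T: "T \<subseteq> {1..m}" and card: "card T \<ge> 1"
  shows "(real (card T) - 1) * R \<le> (\<Sum>i\<in>T. src_ent P {i}) - src_ent P T"
proof -
  let ?k = "real (card T)" and ?L = "log 2 (real (CARD('a) ^ m))"
  let ?D = "(\<Sum>i\<in>T. src_ent P {i}) - src_ent P T"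
  have fT: "finite T" using T finite_subset by blast
  obtain F :: "nat \<Rightarrow> 'a protocol" and K :: "nat \<Rightarrow> (nat \<Rightarrow> nat \<Rightarrow> 'a) \<Rightarrow> nat" where
    FK: "(\<forall>n. \<forall>(i, f)\<in>set (F n). i \<in> T) \<and>
      (\<forall>\<epsilon>. 0 < \<epsilon> \<and> \<epsilon> < 1 \<longrightarrow>
         (\<forall>\<^sub>F n in sequentially. \<exists>J :: nat \<Rightarrow> (nat \<Rightarrow> 'a) \<Rightarrow> nat list \<Rightarrow> nat.
            measure_pmf.prob (iid P m n)
              {xs. \<forall>i\<in>{1..m}. J i (\<lambda>t. xs t i) (transcript (F n) xs) = K n xs} \<ge> 1 - \<epsilon>)) \<and>
      (\<forall>\<epsilon>>0. \<forall>\<^sub>F n in sequentially.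
         mutual_info (iid P m n) (K n) (transcript (F n)) \<le> \<epsilon> \<and>
         rv_ent (iid P m n) (K n) / real n \<ge> R - \<epsilon>)"
    using ach unfolding sk_achievable_def by (elim exE) (rule that)
  note speakers = FK[THEN conjunct1, THEN spec]
  note recover = FK[THEN conjunct2, THEN conjunct1, rule_format, OF conjI]
  note secret = FK[THEN conjunct2, THEN conjunct2, rule_format]
  have single_letter: "(?k - 1) * (n * (R - \<epsilon>) - \<epsilon>) \<le> n * ?D + ?k * (1 + \<epsilon> * (n * ?L))"
    if n: "n > 0"
      and J: "measure_pmf.prob (iid P m n)
         {xs. \<forall>i\<in>{1..m}. J i (\<lambda>t. xs t i) (transcript (F n) xs) = K n xs} \<ge> 1 - \<epsilon>"
      and sec: "mutual_info (iid P m n) (K n) (transcript (F n)) \<le> \<epsilon>"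
      and rate: "rv_ent (iid P m n) (K n) / real n \<ge> R - \<epsilon>"
    for n \<epsilon> and J :: "nat \<Rightarrow> (nat \<Rightarrow> 'a) \<Rightarrow> nat list \<Rightarrow> nat"
  proof -
    let ?p = "iid P m n"
    have fin: "finite (set_pmf ?p)" by (rule set_iid)
    have "card (K n ` set_pmf ?p) \<le> (CARD('a) ^ m) ^ n"
      using card_image_le[OF fin, of "K n"] set_iid(2)[of P m n] by linarith
    then have N: "real (card (K n ` set_pmf ?p)) \<le> real (CARD('a) ^ m) ^ n"
      by (metis of_nat_le_iff of_nat_power)
    have log_N: "log 2 (real (CARD('a) ^ m) ^ n) = n * ?L"
      by (simp add: log_nat_power)
    have "rv_ent ?p (\<lambda>xs. (K n xs, \<lambda>t. xs t i, transcript (F n) xs))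
        - rv_ent ?p (\<lambda>xs. (\<lambda>t. xs t i, transcript (F n) xs)) \<le> 1 + \<epsilon> * (n * ?L)"
      if i: "i \<in> T" for i
    proof -
      \<comment> \<open>Agreement of all terminals with the key implies that terminal
        \<open>i\<close> alone recovers it from its observation and the transcript.\<close>
      have "1 - \<epsilon> \<le> measure_pmf.prob ?p
          {xs. (\<lambda>(x, c). J i x c) (\<lambda>t. xs t i, transcript (F n) xs) = K n xs}"
        using i T by (intro order_trans[OF J] measure_pmf.finite_measure_mono) auto
      from fano_inequality[where j = "\<lambda>(x, c). J i x c"
          and Z = "\<lambda>xs. (\<lambda>t. xs t i, transcript (F n) xs)", OF fin N this]
      show ?thesis by (simp only: log_N)
    qed
    note conv = secret_key_converse[OF fin fT speakers this]
    have "rv_ent ?p (\<lambda>xs t. xs t i) = n * src_ent P {i}" if i: "i \<in> T" for i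
    proof -
      have "rv_ent ?p (\<lambda>xs t. xs t i) = rv_ent ?p (\<lambda>xs t. restrict (xs t) {i})"
        by (rule rv_ent_cong[OF fin]) (auto simp: restrict_def fun_eq_iff)
      then show ?thesis using i T by (subst (asm) rv_ent_iid) auto
    qed
    then have "(\<Sum>i\<in>T. rv_ent ?p (\<lambda>xs t. xs t i)) - rv_ent ?p (\<lambda>xs t. restrict (xs t) T) = n * ?D"
      using T by (simp add: rv_ent_iid sum_distrib_left right_diff_distrib)
    moreover have "(?k - 1) * (n * (R - \<epsilon>) - \<epsilon>)
        \<le> (?k - 1) * (rv_ent ?p (K n) - mutual_info ?p (K n) (transcript (F n)))"
      using card n sec rate by (intro mult_left_mono diff_mono) (auto simp: field_simps)
    ultimately show ?thesis using conv by simp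
  qed
  \<comment> \<open>With the error fixed, division by \<open>n\<close> removes Fano's constant bit
    and the leaked information; the part \<open>?k * \<epsilon> * ?L\<close>, linear in the error,
    survives.\<close>
  have "(?k - 1) * (R - \<epsilon>) \<le> ?D + ?k * \<epsilon> * ?L" if \<epsilon>: "0 < \<epsilon>" "\<epsilon> < 1" for \<epsilon>
  proof (rule tendsto_le)
    show "((\<lambda>n. (?k - 1) * (R - \<epsilon>) - (?k - 1) * \<epsilon> * (1 / real n)) \<longlongrightarrow> (?k - 1) * (R - \<epsilon>)) sequentially"
      by (rule tendsto_eq_intros lim_1_over_n | simp)+
    show "((\<lambda>n. ?D + ?k * \<epsilon> * ?L + ?k * (1 / real n)) \<longlongrightarrow> ?D + ?k * \<epsilon> * ?L) sequentially"
      by (rule tendsto_eq_intros lim_1_over_n | simp)+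
    show "\<forall>\<^sub>F n in sequentially. (?k - 1) * (R - \<epsilon>) - (?k - 1) * \<epsilon> * (1 / real n)
        \<le> ?D + ?k * \<epsilon> * ?L + ?k * (1 / real n)"
      using recover[OF \<epsilon>] secret[OF \<epsilon>(1)] eventually_gt_at_top[of 0]
    proof eventually_elim
      case (elim n)
      then obtain J :: "nat \<Rightarrow> (nat \<Rightarrow> 'a) \<Rightarrow> nat list \<Rightarrow> nat" where
        "measure_pmf.prob (iid P m n)
          {xs. \<forall>i\<in>{1..m}. J i (\<lambda>t. xs t i) (transcript (F n) xs) = K n xs} \<ge> 1 - \<epsilon>"
        by blast
      from single_letter[OF _ this] elim
      have "(?k - 1) * (n * (R - \<epsilon>) - \<epsilon>) / n \<le> (n * ?D + ?k * (1 + \<epsilon> * (n * ?L))) / n"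
        by (intro divide_right_mono) auto
      moreover have "(?k - 1) * (n * (R - \<epsilon>) - \<epsilon>) / n
          = (?k - 1) * (R - \<epsilon>) - (?k - 1) * \<epsilon> * (1 / real n)"
        using elim by (simp add: field_simps)
      moreover have "(n * ?D + ?k * (1 + \<epsilon> * (n * ?L))) / n
          = ?D + ?k * \<epsilon> * ?L + ?k * (1 / real n)"
        using elim by (simp add: field_simps)
      ultimately show ?case by simp
    qed
  qed simp
  \<comment> \<open>The second limit, error to zero from the right, removes the surviving
    terms.\<close>
  then have "\<forall>\<^sub>F \<epsilon> in at_right 0. (?k - 1) * (R - \<epsilon>) \<le> ?D + ?k * \<epsilon> * ?L"
    unfolding eventually_at_right_field by (intro exI[of _ 1]) simp
  moreover have "((\<lambda>\<epsilon>. (?k - 1) * (R - \<epsilon>)) \<longlongrightarrow> (?k - 1) * R) (at_right 0)"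
    by (rule tendsto_eq_intros | simp)+
  moreover have "((\<lambda>\<epsilon>. ?D + ?k * \<epsilon> * ?L) \<longlongrightarrow> ?D) (at_right 0)"
    by (rule tendsto_eq_intros | simp)+
  ultimately show ?thesis
    by (intro tendsto_le[OF trivial_limit_at_right_real])
qed

text \<open>Silence and a constant key. It supplies the nonempty set of rates that bounding a real
  supremum from above requires.\<close>

lemma sk_achievable_0: "sk_achievable P m S 0"
proof -
  let ?F = "\<lambda>_. [] :: 'a protocol" and ?K = "\<lambda>_ _. 0 :: nat"
  have "transcript [] = (\<lambda>_ :: nat \<Rightarrow> nat \<Rightarrow> 'a. [])"
    by (simp add: transcript_def fun_eq_iff)
  then show ?thesis
    unfolding sk_achievable_def
    by (intro exI[of _ ?F] exI[of _ ?K])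
      (auto simp: mutual_info_def rv_ent_const intro!: always_eventually exI[of _ "\<lambda>_ _ _. 0"])
qed

section \<open>The strict gap for strict Type S sources\<close>

theorem theorem4:
  fixes P :: "(nat \<Rightarrow> 'a::finite) pmf" and m :: nat and T :: "nat set"
  assumes "m \<ge> 3"
    and "strict_type_S P m"
    and "T \<subseteq> {1..m}"
    and "card T = m - 1"
  shows "sk_cap_restricted P m T < mmi P m"
proof -
  let ?S = "singleton_partition m" and ?s = "Delta P m (singleton_partition m)"
  let ?D = "(\<Sum>i\<in>T. src_ent P {i}) - src_ent P T"
  have S: "?S \<in> partitions2 m"
    and S_min: "\<And>Q. Q \<in> partitions2 m \<Longrightarrow> ?s \<le> Delta P m Q"
    and S_uniq: "\<And>Q. Q \<in> partitions2 m \<Longrightarrow> Delta P m Q = ?s \<Longrightarrow> Q = ?S"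
    using assms(2) unfolding strict_type_S_def by auto
  have "partitions2 m \<subseteq> Pow (Pow {1..m})"
    by (auto simp: partitions2_def partition_on_def)
  then have "finite (partitions2 m)" by (rule finite_subset) simp
  then have mmi: "mmi P m = ?s"
    unfolding mmi_def using S S_min by (intro Min_eqI) auto
  have fT: "finite T" using assms(3) finite_subset by blast
  have "card ({1..m} - T) = 1"
    using assms fT by (simp add: card_Diff_subset)
  then obtain u where u: "{1..m} - T = {u}" by (auto simp: card_1_singleton_iff)
  then have uT: "u \<notin> T" and M: "{1..m} = insert u T" using assms(3) by auto
  have T2: "card T \<ge> 2" using assms by simp
  then have T_ne: "T \<noteq> {}" and uTne: "{u} \<noteq> T" using uT by auto
  have "partition_on {1..m} {{u}, T}"
    unfolding M using uT T_ne by (auto simp: partition_on_def disjoint_def)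
  then have Q: "{{u}, T} \<in> partitions2 m"
    using uTne by (simp add: partitions2_def)
  \<comment> \<open>Here \<open>m >= 3\<close> enters: \<open>T\<close> has at least two elements,
    so the two-cell partition is not the singleton partition and uniqueness gives a strict
    inequality.\<close>
  have "T \<notin> ?S" using T2 by (auto simp: singleton_partition_def)
  then have "{{u}, T} \<noteq> ?S" by auto
  then have "?s < Delta P m {{u}, T}"
    using S_min[OF Q] S_uniq[OF Q] by linarith
  also have "\<dots> = src_ent P {u} + src_ent P T - src_ent P {1..m}"
    using uTne by (simp add: Delta_def)
  finally have less: "?s < src_ent P {u} + src_ent P T - src_ent P {1..m}" .
  have "(\<Sum>A\<in>?S. src_ent P A) = (\<Sum>i\<in>{1..m}. src_ent P {i})"
    unfolding singleton_partition_def by (subst sum.reindex) auto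
  also have "\<dots> = src_ent P {u} + (\<Sum>i\<in>T. src_ent P {i})"
    unfolding M using uT fT by simp
  finally have sum_S: "(\<Sum>A\<in>?S. src_ent P A) = src_ent P {u} + (\<Sum>i\<in>T. src_ent P {i})" .
  have "card ?S = m"
    unfolding singleton_partition_def by (subst card_image) auto
  then have "(real m - 1) * ?s = src_ent P {u} + (\<Sum>i\<in>T. src_ent P {i}) - src_ent P {1..m}"
    using assms(1) by (simp add: Delta_def sum_S)
  \<comment> \<open>Subtracting the strict bound on one copy of \<open>?s\<close> from the formula
    for \<open>m - 1\<close> copies cancels the terms of \<open>u\<close> and of all
    terminals.\<close>
  then have "?D < (real m - 2) * ?s" using less by (simp add: algebra_simps)
  then have D: "?D / (real m - 2) < ?s"
    using assms(1) by (simp add: pos_divide_less_eq mult.commute)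
  \<comment> \<open>All rates obey the same bound, itself strictly below \<open>?s\<close>, so
    strictness survives the supremum.\<close>
  have "sk_cap_restricted P m T \<le> ?D / (real m - 2)"
    unfolding sk_cap_restricted_def
  proof (rule cSup_least)
    show "{R. sk_achievable P m T R} \<noteq> {}" using sk_achievable_0 by auto
    fix R assume "R \<in> {R. sk_achievable P m T R}"
    then have "(real (card T) - 1) * R \<le> ?D"
      using assms(3) T2 by (intro sk_achievable_le) auto
    moreover have "real (card T) - 1 = real m - 2" using assms(1,4) by simp
    ultimately show "R \<le> ?D / (real m - 2)"
      using assms(1) by (simp add: pos_le_divide_eq mult.commute)
  qed
  then show ?thesis using D mmi by linarith
qed

end
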